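(* Let $\mathcal{D}$ be a background theory in the language of the situation calculus with real-valued time, and let $f(\bar{x},t,s)$ be a temporal functional fluent. Let $k\ge 1$ and let there be given $k$ temporal change axioms for $f$, $$\gamma_i(\bar{x},s)\land\delta_i(\bar{x},y,t,s)\to f(\bar{x},t,s)=y,\qquad 1\le i\le k,$$ where $\gamma_i(\bar{x},s)$ and $\delta_i(\bar{x},y,t,s)$ are formulas uniform in $s$ whose free variables are among those shown. Put $$\Phi(\bar{x},y,t,s):=\bigvee_{1\le i\le k}\bigl(\gamma_i(\bar{x},s)\land\delta_i(\bar{x},y,t,s)\bigr),\qquad \Psi(\bar{x},s):=\bigvee_{1\le i\le k}\gamma_i(\bar{x},s).$$ Suppose that for each $i$ the theory $\mathcal{D}$ entails the universal closure of $\gamma_i(\bar{x},s)\to\exists y\,\delta_i(\bar{x},y,t,s)$. Then, in the models (of $\mathcal{D}$) of the consistency condition $$\Phi(\bar{x},y,t,s)\land\Phi(\bar{x},y',t,s)\to y=y',$$ the conjunction of the two axioms $$\Phi(\bar{x},y,t,s)\to f(\bar{x},t,s)=y,$$ $$f(\bar{x},t,s)\neq f(\bar{x},\mathit{start}(s),s)\to\exists y\,\Phi(\bar{x},y,t,s)$$ is logically equivalent to $$f(\bar{x},t,s)=y\;\leftrightarrow\;\bigl[\Phi(\bar{x},y,t,s)\;\lor\;\bigl(y=f(\bar{x},\mathit{start}(s),s)\land\neg\Psi(\bar{x},s)\bigr)\bigr].$$ (All displayed axioms are understood to be universally closed.)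
   Context: The situation calculus is a many-sorted logic with sorts situation, action, object, here extended by sorts for real-valued time and real-valued quantities. A temporal functional fluent $f(\bar{x},t,s)$ is a function symbol whose last argument $s$ is of sort situation, whose next-to-last argument $t$ is of sort time, and whose values are real-valued quantities. $\mathit{start}$ is a function symbol from situations to time; $\mathit{start}(s)$ is the starting time of situation $s$. A formula is uniform in the situation variable $s$ if it does not mention the predicate $\mathit{Poss}$ (action possibility) or $\sqsubseteq$ (the ordering on situations), does not quantify over situations, does not mention equality on situations, and has no situation term other than $s$. "Logically equivalent in the models of a condition" means that in every model of $\mathcal{D}$ that satisfies the (universally closed) condition, the one sentence is true iff the other is. *)

theory Defs
  imports Complex_Main
begin

section \<open>Syntax of the situation calculus with real-valued time\<close>

datatype rsort = TimeR | QtyR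

datatype sort = Sit | Act | Obj | RealS rsort

abbreviation Time :: sort where "Time \<equiv> RealS TimeR"
abbreviation Qty :: sort where "Qty \<equiv> RealS QtyR"

text \<open>Each variable carries its sort, each relation variable its argument sorts. Relation variables
  are there because theories of the situation calculus usually contain second-order sentences
  (induction over situations).\<close>

type_synonym var = "sort \<times> nat"
type_synonym rvar = "sort list \<times> nat"

text \<open>Besides the symbols specific to the situation calculus, the language has real arithmetic on
  the two real-valued sorts (\<open>Conv\<close> translates between times and quantities), which is interpreted
  in the standard way in every structure. All other symbols come from the arbitrary types
  \<open>'f\<close> and \<open>'p\<close>.\<close>

datatype 'f fsym = S0 | Do | Start
  | Const rsort real | Plus rsort | Times rsort | Conv rsort rsort
  | Fun 'f

datatype 'p psym = Poss | Prec | Less rsort | Pred 'p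

datatype 'f tm = Var var | Fn "'f fsym" "'f tm list"

datatype ('f, 'p) fm =
    Fls
  | Eq "'f tm" "'f tm"
  | Rel "'p psym" "'f tm list"
  | RVar rvar "'f tm list"
  | Neg "('f, 'p) fm"
  | And "('f, 'p) fm" "('f, 'p) fm"
  | Or "('f, 'p) fm" "('f, 'p) fm"
  | Imp "('f, 'p) fm" "('f, 'p) fm"
  | Iff "('f, 'p) fm" "('f, 'p) fm"
  | Forall var "('f, 'p) fm"
  | Exists var "('f, 'p) fm"
  | AllR rvar "('f, 'p) fm"
  | ExR rvar "('f, 'p) fm"

record ('f, 'p) signature =
  fun_sig :: "'f \<Rightarrow> sort list \<times> sort"
  pred_sig :: "'p \<Rightarrow> sort list"

fun fsig :: "('f, 'p) signature \<Rightarrow> 'f fsym \<Rightarrow> sort list \<times> sort" where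
  "fsig Sg S0 = ([], Sit)"
| "fsig Sg Do = ([Act, Sit], Sit)"
| "fsig Sg Start = ([Sit], Time)"
| "fsig Sg (Const \<rho> c) = ([], RealS \<rho>)"
| "fsig Sg (Plus \<rho>) = ([RealS \<rho>, RealS \<rho>], RealS \<rho>)"
| "fsig Sg (Times \<rho>) = ([RealS \<rho>, RealS \<rho>], RealS \<rho>)"
| "fsig Sg (Conv \<rho> \<rho>') = ([RealS \<rho>], RealS \<rho>')"
| "fsig Sg (Fun f) = fun_sig Sg f"

fun psig :: "('f, 'p) signature \<Rightarrow> 'p psym \<Rightarrow> sort list" where
  "psig Sg Poss = [Act, Sit]"
| "psig Sg Prec = [Sit, Sit]"
| "psig Sg (Less \<rho>) = [RealS \<rho>, RealS \<rho>]"
| "psig Sg (Pred p) = pred_sig Sg p"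

fun tsort :: "('f, 'p) signature \<Rightarrow> 'f tm \<Rightarrow> sort" where
  "tsort Sg (Var v) = fst v"
| "tsort Sg (Fn g ts) = snd (fsig Sg g)"

fun wf_tm :: "('f, 'p) signature \<Rightarrow> 'f tm \<Rightarrow> bool" where
  "wf_tm Sg (Var v) \<longleftrightarrow> True"
| "wf_tm Sg (Fn g ts) \<longleftrightarrow> map (tsort Sg) ts = fst (fsig Sg g) \<and> (\<forall>t\<in>set ts. wf_tm Sg t)"

fun wf_fm :: "('f, 'p) signature \<Rightarrow> ('f, 'p) fm \<Rightarrow> bool" where
  "wf_fm Sg Fls \<longleftrightarrow> True"
| "wf_fm Sg (Eq t u) \<longleftrightarrow> wf_tm Sg t \<and> wf_tm Sg u \<and> tsort Sg t = tsort Sg u"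
| "wf_fm Sg (Rel p ts) \<longleftrightarrow> map (tsort Sg) ts = psig Sg p \<and> (\<forall>t\<in>set ts. wf_tm Sg t)"
| "wf_fm Sg (RVar P ts) \<longleftrightarrow> map (tsort Sg) ts = fst P \<and> (\<forall>t\<in>set ts. wf_tm Sg t)"
| "wf_fm Sg (Neg \<phi>) \<longleftrightarrow> wf_fm Sg \<phi>"
| "wf_fm Sg (And \<phi> \<psi>) \<longleftrightarrow> wf_fm Sg \<phi> \<and> wf_fm Sg \<psi>"
| "wf_fm Sg (Or \<phi> \<psi>) \<longleftrightarrow> wf_fm Sg \<phi> \<and> wf_fm Sg \<psi>"
| "wf_fm Sg (Imp \<phi> \<psi>) \<longleftrightarrow> wf_fm Sg \<phi> \<and> wf_fm Sg \<psi>"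
| "wf_fm Sg (Iff \<phi> \<psi>) \<longleftrightarrow> wf_fm Sg \<phi> \<and> wf_fm Sg \<psi>"
| "wf_fm Sg (Forall v \<phi>) \<longleftrightarrow> wf_fm Sg \<phi>"
| "wf_fm Sg (Exists v \<phi>) \<longleftrightarrow> wf_fm Sg \<phi>"
| "wf_fm Sg (AllR P \<phi>) \<longleftrightarrow> wf_fm Sg \<phi>"
| "wf_fm Sg (ExR P \<phi>) \<longleftrightarrow> wf_fm Sg \<phi>"

fun tvars :: "'f tm \<Rightarrow> var set" where
  "tvars (Var v) = {v}"
| "tvars (Fn g ts) = (\<Union>t\<in>set ts. tvars t)"

fun fv :: "('f, 'p) fm \<Rightarrow> var set" where
  "fv Fls = {}"
| "fv (Eq t u) = tvars t \<union> tvars u"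
| "fv (Rel p ts) = (\<Union>t\<in>set ts. tvars t)"
| "fv (RVar P ts) = (\<Union>t\<in>set ts. tvars t)"
| "fv (Neg \<phi>) = fv \<phi>"
| "fv (And \<phi> \<psi>) = fv \<phi> \<union> fv \<psi>"
| "fv (Or \<phi> \<psi>) = fv \<phi> \<union> fv \<psi>"
| "fv (Imp \<phi> \<psi>) = fv \<phi> \<union> fv \<psi>"
| "fv (Iff \<phi> \<psi>) = fv \<phi> \<union> fv \<psi>"
| "fv (Forall v \<phi>) = fv \<phi> - {v}"
| "fv (Exists v \<phi>) = fv \<phi> - {v}"
| "fv (AllR P \<phi>) = fv \<phi>"
| "fv (ExR P \<phi>) = fv \<phi>"

fun frv :: "('f, 'p) fm \<Rightarrow> rvar set" where
  "frv Fls = {}"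
| "frv (Eq t u) = {}"
| "frv (Rel p ts) = {}"
| "frv (RVar P ts) = {P}"
| "frv (Neg \<phi>) = frv \<phi>"
| "frv (And \<phi> \<psi>) = frv \<phi> \<union> frv \<psi>"
| "frv (Or \<phi> \<psi>) = frv \<phi> \<union> frv \<psi>"
| "frv (Imp \<phi> \<psi>) = frv \<phi> \<union> frv \<psi>"
| "frv (Iff \<phi> \<psi>) = frv \<phi> \<union> frv \<psi>"
| "frv (Forall v \<phi>) = frv \<phi>"
| "frv (Exists v \<phi>) = frv \<phi>"
| "frv (AllR P \<phi>) = frv \<phi> - {P}"
| "frv (ExR P \<phi>) = frv \<phi> - {P}"

definition sentence :: "('f, 'p) signature \<Rightarrow> ('f, 'p) fm \<Rightarrow> bool" where
  "sentence Sg \<phi> \<longleftrightarrow> wf_fm Sg \<phi> \<and> fv \<phi> = {} \<and> frv \<phi> = {}"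

definition is_theory :: "('f, 'p) signature \<Rightarrow> ('f, 'p) fm set \<Rightarrow> bool" where
  "is_theory Sg D \<longleftrightarrow> (\<forall>\<phi>\<in>D. sentence Sg \<phi>)"

fun BigOr :: "('f, 'p) fm list \<Rightarrow> ('f, 'p) fm" where
  "BigOr [] = Fls"
| "BigOr [\<phi>] = \<phi>"
| "BigOr (\<phi> # \<psi> # \<phi>s) = Or \<phi> (BigOr (\<psi> # \<phi>s))"

definition Alls :: "var list \<Rightarrow> ('f, 'p) fm \<Rightarrow> ('f, 'p) fm" where
  "Alls vs \<phi> = foldr Forall vs \<phi>"

text \<open>Capture-avoiding simultaneous substitution: a bound variable is renamed if it occurs in a
  term that is substituted into its scope.\<close>

definition fresh :: "var \<Rightarrow> var set \<Rightarrow> var" where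
  "fresh v W = (if v \<notin> W then v else (fst v, LEAST n. (fst v, n) \<notin> W))"

fun tsubst :: "(var \<Rightarrow> 'f tm) \<Rightarrow> 'f tm \<Rightarrow> 'f tm" where
  "tsubst \<theta> (Var v) = \<theta> v"
| "tsubst \<theta> (Fn g ts) = Fn g (map (tsubst \<theta>) ts)"

fun subst :: "(var \<Rightarrow> 'f tm) \<Rightarrow> ('f, 'p) fm \<Rightarrow> ('f, 'p) fm" where
  "subst \<theta> Fls = Fls"
| "subst \<theta> (Eq t u) = Eq (tsubst \<theta> t) (tsubst \<theta> u)"
| "subst \<theta> (Rel p ts) = Rel p (map (tsubst \<theta>) ts)"
| "subst \<theta> (RVar P ts) = RVar P (map (tsubst \<theta>) ts)"
| "subst \<theta> (Neg \<phi>) = Neg (subst \<theta> \<phi>)"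
| "subst \<theta> (And \<phi> \<psi>) = And (subst \<theta> \<phi>) (subst \<theta> \<psi>)"
| "subst \<theta> (Or \<phi> \<psi>) = Or (subst \<theta> \<phi>) (subst \<theta> \<psi>)"
| "subst \<theta> (Imp \<phi> \<psi>) = Imp (subst \<theta> \<phi>) (subst \<theta> \<psi>)"
| "subst \<theta> (Iff \<phi> \<psi>) = Iff (subst \<theta> \<phi>) (subst \<theta> \<psi>)"
| "subst \<theta> (Forall v \<phi>) =
     (let v' = fresh v (\<Union>w\<in>fv \<phi> - {v}. tvars (\<theta> w)) in Forall v' (subst (\<theta>(v := Var v')) \<phi>))"
| "subst \<theta> (Exists v \<phi>) =
     (let v' = fresh v (\<Union>w\<in>fv \<phi> - {v}. tvars (\<theta> w)) in Exists v' (subst (\<theta>(v := Var v')) \<phi>))"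
| "subst \<theta> (AllR P \<phi>) = AllR P (subst \<theta> \<phi>)"
| "subst \<theta> (ExR P \<phi>) = ExR P (subst \<theta> \<phi>)"

definition rename_free :: "var \<Rightarrow> var \<Rightarrow> ('f, 'p) fm \<Rightarrow> ('f, 'p) fm" where
  "rename_free v w \<phi> = subst (Var(v := Var w)) \<phi>"


section \<open>Uniform formulas\<close>

fun uniform_tm :: "('f, 'p) signature \<Rightarrow> var \<Rightarrow> 'f tm \<Rightarrow> bool" where
  "uniform_tm Sg s (Var v) \<longleftrightarrow> (fst v = Sit \<longrightarrow> v = s)"
| "uniform_tm Sg s (Fn g ts) \<longleftrightarrow> snd (fsig Sg g) \<noteq> Sit \<and> (\<forall>t\<in>set ts. uniform_tm Sg s t)"

text \<open>Quantifying over relations that take situations as arguments counts as quantifying over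
  situations.\<close>

fun uniform :: "('f, 'p) signature \<Rightarrow> var \<Rightarrow> ('f, 'p) fm \<Rightarrow> bool" where
  "uniform Sg s Fls \<longleftrightarrow> True"
| "uniform Sg s (Eq t u) \<longleftrightarrow>
     tsort Sg t \<noteq> Sit \<and> tsort Sg u \<noteq> Sit \<and> uniform_tm Sg s t \<and> uniform_tm Sg s u"
| "uniform Sg s (Rel p ts) \<longleftrightarrow> p \<noteq> Poss \<and> p \<noteq> Prec \<and> (\<forall>t\<in>set ts. uniform_tm Sg s t)"
| "uniform Sg s (RVar P ts) \<longleftrightarrow> (\<forall>t\<in>set ts. uniform_tm Sg s t)"
| "uniform Sg s (Neg \<phi>) \<longleftrightarrow> uniform Sg s \<phi>"
| "uniform Sg s (And \<phi> \<psi>) \<longleftrightarrow> uniform Sg s \<phi> \<and> uniform Sg s \<psi>"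
| "uniform Sg s (Or \<phi> \<psi>) \<longleftrightarrow> uniform Sg s \<phi> \<and> uniform Sg s \<psi>"
| "uniform Sg s (Imp \<phi> \<psi>) \<longleftrightarrow> uniform Sg s \<phi> \<and> uniform Sg s \<psi>"
| "uniform Sg s (Iff \<phi> \<psi>) \<longleftrightarrow> uniform Sg s \<phi> \<and> uniform Sg s \<psi>"
| "uniform Sg s (Forall v \<phi>) \<longleftrightarrow> fst v \<noteq> Sit \<and> uniform Sg s \<phi>"
| "uniform Sg s (Exists v \<phi>) \<longleftrightarrow> fst v \<noteq> Sit \<and> uniform Sg s \<phi>"
| "uniform Sg s (AllR P \<phi>) \<longleftrightarrow> Sit \<notin> set (fst P) \<and> uniform Sg s \<phi>"
| "uniform Sg s (ExR P \<phi>) \<longleftrightarrow> Sit \<notin> set (fst P) \<and> uniform Sg s \<phi>"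

definition uniform_formula ::
  "('f, 'p) signature \<Rightarrow> var \<Rightarrow> var set \<Rightarrow> ('f, 'p) fm \<Rightarrow> bool" where
  "uniform_formula Sg s V \<phi> \<longleftrightarrow>
     wf_fm Sg \<phi> \<and> uniform Sg s \<phi> \<and> fv \<phi> \<subseteq> V \<and> frv \<phi> = {}"


section \<open>Semantics\<close>

text \<open>The domains of the sorts situation, action and object are arbitrary nonempty sets of values;
  the domains of time and of quantities are copies of the reals.\<close>

datatype 'u val = Elem 'u | Real real

record ('f, 'p, 'u) interp =
  carrier :: "sort \<Rightarrow> 'u val set"
  fint :: "'f fsym \<Rightarrow> 'u val list \<Rightarrow> 'u val"
  pint :: "'p psym \<Rightarrow> 'u val list \<Rightarrow> bool"

definition tuples :: "('f, 'p, 'u) interp \<Rightarrow> sort list \<Rightarrow> 'u val list set" where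
  "tuples M \<sigma>s = {vs. list_all2 (\<lambda>a \<sigma>. a \<in> carrier M \<sigma>) vs \<sigma>s}"

definition sitcalc_structure :: "('f, 'p) signature \<Rightarrow> ('f, 'p, 'u) interp \<Rightarrow> bool" where
  "sitcalc_structure Sg M \<longleftrightarrow>
     (\<forall>\<sigma>. carrier M \<sigma> \<noteq> {}) \<and>
     (\<forall>\<rho>. carrier M (RealS \<rho>) = range Real) \<and>
     (\<forall>g. \<forall>vs\<in>tuples M (fst (fsig Sg g)). fint M g vs \<in> carrier M (snd (fsig Sg g))) \<and>
     (\<forall>\<rho> c. fint M (Const \<rho> c) [] = Real c) \<and>
     (\<forall>\<rho> a b. fint M (Plus \<rho>) [Real a, Real b] = Real (a + b)) \<and>
     (\<forall>\<rho> a b. fint M (Times \<rho>) [Real a, Real b] = Real (a * b)) \<and>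
     (\<forall>\<rho> \<rho>' a. fint M (Conv \<rho> \<rho>') [Real a] = Real a) \<and>
     (\<forall>\<rho> a b. pint M (Less \<rho>) [Real a, Real b] \<longleftrightarrow> a < b)"

fun eval :: "('f, 'p, 'u) interp \<Rightarrow> (var \<Rightarrow> 'u val) \<Rightarrow> 'f tm \<Rightarrow> 'u val" where
  "eval M e (Var v) = e v"
| "eval M e (Fn g ts) = fint M g (map (eval M e) ts)"

fun sat :: "('f, 'p, 'u) interp \<Rightarrow> (var \<Rightarrow> 'u val) \<Rightarrow> (rvar \<Rightarrow> 'u val list set) \<Rightarrow>
    ('f, 'p) fm \<Rightarrow> bool" where
  "sat M e r Fls \<longleftrightarrow> False"
| "sat M e r (Eq t u) \<longleftrightarrow> eval M e t = eval M e u"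
| "sat M e r (Rel p ts) \<longleftrightarrow> pint M p (map (eval M e) ts)"
| "sat M e r (RVar P ts) \<longleftrightarrow> map (eval M e) ts \<in> r P"
| "sat M e r (Neg \<phi>) \<longleftrightarrow> \<not> sat M e r \<phi>"
| "sat M e r (And \<phi> \<psi>) \<longleftrightarrow> sat M e r \<phi> \<and> sat M e r \<psi>"
| "sat M e r (Or \<phi> \<psi>) \<longleftrightarrow> sat M e r \<phi> \<or> sat M e r \<psi>"
| "sat M e r (Imp \<phi> \<psi>) \<longleftrightarrow> (sat M e r \<phi> \<longrightarrow> sat M e r \<psi>)"
| "sat M e r (Iff \<phi> \<psi>) \<longleftrightarrow> (sat M e r \<phi> \<longleftrightarrow> sat M e r \<psi>)"
| "sat M e r (Forall v \<phi>) \<longleftrightarrow> (\<forall>a\<in>carrier M (fst v). sat M (e(v := a)) r \<phi>)"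
| "sat M e r (Exists v \<phi>) \<longleftrightarrow> (\<exists>a\<in>carrier M (fst v). sat M (e(v := a)) r \<phi>)"
| "sat M e r (AllR P \<phi>) \<longleftrightarrow> (\<forall>R. R \<subseteq> tuples M (fst P) \<longrightarrow> sat M e (r(P := R)) \<phi>)"
| "sat M e r (ExR P \<phi>) \<longleftrightarrow> (\<exists>R. R \<subseteq> tuples M (fst P) \<and> sat M e (r(P := R)) \<phi>)"

definition assignment ::
  "('f, 'p, 'u) interp \<Rightarrow> (var \<Rightarrow> 'u val) \<Rightarrow> (rvar \<Rightarrow> 'u val list set) \<Rightarrow> bool" where
  "assignment M e r \<longleftrightarrow> (\<forall>v. e v \<in> carrier M (fst v)) \<and> (\<forall>P. r P \<subseteq> tuples M (fst P))"

definition true_in :: "('f, 'p, 'u) interp \<Rightarrow> ('f, 'p) fm \<Rightarrow> bool"  (infix "\<Turnstile>" 50) where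
  "M \<Turnstile> \<phi> \<longleftrightarrow> (\<forall>e r. assignment M e r \<longrightarrow> sat M e r \<phi>)"

definition model :: "('f, 'p) signature \<Rightarrow> ('f, 'p) fm set \<Rightarrow> ('f, 'p, 'u) interp \<Rightarrow> bool" where
  "model Sg D M \<longleftrightarrow> sitcalc_structure Sg M \<and> (\<forall>\<phi>\<in>D. M \<Turnstile> \<phi>)"

text \<open>A type cannot be quantified inside a formula, so entailment and equivalence refer to all
  models whose elements are taken from the type \<open>'u\<close> (or are reals); \<open>'u\<close> itself is arbitrary.\<close>

definition entails ::
  "'u itself \<Rightarrow> ('f, 'p) signature \<Rightarrow> ('f, 'p) fm set \<Rightarrow> ('f, 'p) fm \<Rightarrow> bool" where
  "entails _ Sg D \<phi> \<longleftrightarrow> (\<forall>M :: ('f, 'p, 'u) interp. model Sg D M \<longrightarrow> M \<Turnstile> \<phi>)"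

definition equivalent_in_models_of ::
  "'u itself \<Rightarrow> ('f, 'p) signature \<Rightarrow> ('f, 'p) fm set \<Rightarrow> ('f, 'p) fm \<Rightarrow>
    ('f, 'p) fm \<Rightarrow> ('f, 'p) fm \<Rightarrow> bool" where
  "equivalent_in_models_of _ Sg D \<chi> \<phi> \<psi> \<longleftrightarrow>
     (\<forall>M :: ('f, 'p, 'u) interp. model Sg D M \<and> M \<Turnstile> \<chi> \<longrightarrow> (M \<Turnstile> \<phi> \<longleftrightarrow> M \<Turnstile> \<psi>))"


section \<open>Temporal change axioms\<close>

definition temporal_functional_fluent :: "('f, 'p) signature \<Rightarrow> 'f \<Rightarrow> sort list \<Rightarrow> bool" where
  "temporal_functional_fluent Sg f \<sigma>s \<longleftrightarrow> fun_sig Sg f = (\<sigma>s @ [Time, Sit], Qty)"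

definition fluent_tm :: "'f \<Rightarrow> var list \<Rightarrow> 'f tm \<Rightarrow> var \<Rightarrow> 'f tm" where
  "fluent_tm f xs \<tau> s = Fn (Fun f) (map Var xs @ [\<tau>, Var s])"

definition start_tm :: "var \<Rightarrow> 'f tm" where
  "start_tm s = Fn Start [Var s]"

definition Phi :: "nat \<Rightarrow> (nat \<Rightarrow> ('f, 'p) fm) \<Rightarrow> (nat \<Rightarrow> ('f, 'p) fm) \<Rightarrow> ('f, 'p) fm" where
  "Phi k \<gamma> \<delta> = BigOr (map (\<lambda>i. And (\<gamma> i) (\<delta> i)) [1..<k+1])"

definition Psi :: "nat \<Rightarrow> (nat \<Rightarrow> ('f, 'p) fm) \<Rightarrow> ('f, 'p) fm" where
  "Psi k \<gamma> = BigOr (map \<gamma> [1..<k+1])"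

end

theory Submission
  imports Defs
begin

text \<open>The entailments \<open>\<gamma>\<^sub>i \<longrightarrow> (\<exists>y. \<delta>\<^sub>i)\<close> make \<open>\<exists>y. \<Phi>\<close> equivalent to \<open>\<Psi>\<close>, because no
  \<open>\<gamma>\<^sub>i\<close> mentions \<open>y\<close>. So where \<open>\<Psi>\<close> holds, both sides say that \<open>\<Phi>\<close> defines the value of the
  fluent, and where \<open>\<Psi>\<close> fails, both say that the value is the one at \<open>start(s)\<close>. To recover the
  second axiom from the biconditional, instantiate \<open>y\<close> with \<open>f(x, t, s)\<close>, which is a quantity because
  structures respect sorts.\<close>

lemma eval_cong: "(\<And>v. v \<in> tvars u \<Longrightarrow> e v = e' v) \<Longrightarrow> eval M e u = eval M e' u"
proof (induction u)
  case (Fn g us)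
  then have "map (eval M e) us = map (eval M e') us"
    by (intro map_cong) (auto simp del: split_paired_All split_paired_Ex)
  then show ?case by (simp del: map_eq_conv)
qed simp

lemma map_eval_cong:
  "(\<And>v. v \<in> (\<Union>u\<in>set us. tvars u) \<Longrightarrow> e v = e' v) \<Longrightarrow> map (eval M e) us = map (eval M e') us"
  by (auto intro!: eval_cong)

text \<open>Coincidence lemma. It is what allows \<gamma> to ignore the value of \<open>y\<close>.
  The induction keeps \<open>e\<close>, \<open>e'\<close> and \<open>r\<close> arbitrary, since
  quantifiers update them.\<close>

lemma sat_cong: "(\<And>v. v \<in> fv \<phi> \<Longrightarrow> e v = e' v) \<Longrightarrow> sat M e r \<phi> \<longleftrightarrow> sat M e' r \<phi>"
proof (induction \<phi> arbitrary: e e' r)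
  case (Eq u w)
  then show ?case
    using eval_cong[of u e e' M] eval_cong[of w e e' M] by simp
next
  case (Rel p us)
  then show ?case
    using map_eval_cong[of us e e' M] by (simp del: map_eq_conv)
next
  case (RVar P us)
  then show ?case
    using map_eval_cong[of us e e' M] by (simp del: map_eq_conv)
next
  case (Neg \<phi>)
  have "sat M e r \<phi> \<longleftrightarrow> sat M e' r \<phi>"
    using Neg.prems by (intro Neg.IH) simp
  then show ?case by simp
next
  case (And \<phi> \<psi>)
  have "sat M e r \<phi> \<longleftrightarrow> sat M e' r \<phi>" and "sat M e r \<psi> \<longleftrightarrow> sat M e' r \<psi>"
    using And.prems by (auto intro!: And.IH)
  then show ?case by simp
next
  case (Or \<phi> \<psi>)
  have "sat M e r \<phi> \<longleftrightarrow> sat M e' r \<phi>" and "sat M e r \<psi> \<longleftrightarrow> sat M e' r \<psi>"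
    using Or.prems by (auto intro!: Or.IH)
  then show ?case by simp
next
  case (Imp \<phi> \<psi>)
  have "sat M e r \<phi> \<longleftrightarrow> sat M e' r \<phi>" and "sat M e r \<psi> \<longleftrightarrow> sat M e' r \<psi>"
    using Imp.prems by (auto intro!: Imp.IH)
  then show ?case by simp
next
  case (Iff \<phi> \<psi>)
  have "sat M e r \<phi> \<longleftrightarrow> sat M e' r \<phi>" and "sat M e r \<psi> \<longleftrightarrow> sat M e' r \<psi>"
    using Iff.prems by (auto intro!: Iff.IH)
  then show ?case by simp
next
  case (Forall v \<phi>)
  have "sat M (e(v := a)) r \<phi> \<longleftrightarrow> sat M (e'(v := a)) r \<phi>" for a
    using Forall.prems by (intro Forall.IH) simp
  then show ?case by simp
next
  case (Exists v \<phi>)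
  have "sat M (e(v := a)) r \<phi> \<longleftrightarrow> sat M (e'(v := a)) r \<phi>" for a
    using Exists.prems by (intro Exists.IH) simp
  then show ?case by simp
next
  case (AllR P \<phi>)
  have "sat M e (r(P := R)) \<phi> \<longleftrightarrow> sat M e' (r(P := R)) \<phi>" for R
    using AllR.prems by (intro AllR.IH) simp
  then show ?case by simp
next
  case (ExR P \<phi>)
  have "sat M e (r(P := R)) \<phi> \<longleftrightarrow> sat M e' (r(P := R)) \<phi>" for R
    using ExR.prems by (intro ExR.IH) simp
  then show ?case by simp
qed simp

lemma sat_upd_not_free: "v \<notin> fv \<phi> \<Longrightarrow> sat M (e(v := a)) r \<phi> \<longleftrightarrow> sat M e r \<phi>"
  by (rule sat_cong) auto

lemma assignment_upd:
  "assignment M e r \<Longrightarrow> a \<in> carrier M (fst v) \<Longrightarrow> assignment M (e(v := a)) r"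
  by (simp add: assignment_def del: split_paired_All)

text \<open>Truth in \<open>M\<close> already ranges over all well-sorted assignments. One direction
  picks \<open>e v\<close> itself as the instance, so that the update changes nothing; the other
  uses that updating within the carrier yields an assignment again.\<close>

lemma true_in_Forall: "M \<Turnstile> Forall v \<phi> \<longleftrightarrow> M \<Turnstile> \<phi>"
proof
  assume all: "M \<Turnstile> Forall v \<phi>"
  show "M \<Turnstile> \<phi>"
    unfolding true_in_def
  proof (intro allI impI)
    fix e r assume er: "assignment M e r"
    then have "e v \<in> carrier M (fst v)" and "sat M e r (Forall v \<phi>)"
      using all unfolding true_in_def assignment_def by blast+
    then have "sat M (e(v := e v)) r \<phi>"
      unfolding sat.simps by blast
    then show "sat M e r \<phi>" by simp
  qed
qed (simp add: true_in_def assignment_upd)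

lemma true_in_Alls: "M \<Turnstile> Alls vs \<phi> \<longleftrightarrow> M \<Turnstile> \<phi>"
  by (induction vs) (simp_all add: Alls_def true_in_Forall)

lemma true_in_And: "M \<Turnstile> And \<phi> \<psi> \<longleftrightarrow> M \<Turnstile> \<phi> \<and> M \<Turnstile> \<psi>"
  by (auto simp: true_in_def)

lemma sat_BigOr: "sat M e r (BigOr \<phi>s) \<longleftrightarrow> (\<exists>\<phi>\<in>set \<phi>s. sat M e r \<phi>)"
  by (induction \<phi>s rule: BigOr.induct) auto

text \<open>The half-open list \<open>[1..<k+1]\<close> enumerates exactly the indices
  \<open>{1..k}\<close>.\<close>

lemma sat_Phi:
  "sat M e r (Phi k \<gamma> \<delta>) \<longleftrightarrow> (\<exists>i\<in>{1..k}. sat M e r (\<gamma> i) \<and> sat M e r (\<delta> i))"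
  by (auto simp: Phi_def sat_BigOr)

lemma sat_Psi: "sat M e r (Psi k \<gamma>) \<longleftrightarrow> (\<exists>i\<in>{1..k}. sat M e r (\<gamma> i))"
  by (auto simp: Psi_def sat_BigOr)

text \<open>A well-sorted assignment sends the argument variables to a tuple of the declared sorts,
  and a structure maps such tuples into the carrier of the result sort. This makes the value of the
  fluent a legitimate instance for \<open>y\<close>.\<close>

lemma eval_fluent_in_carrier:
  assumes "sitcalc_structure Sg M" and "temporal_functional_fluent Sg f (map fst xs)"
    and "fst t = Time" and "fst s = Sit" and "assignment M e r"
  shows "eval M e (fluent_tm f xs (Var t) s) \<in> carrier M Qty"
proof -
  have "fsig Sg (Fun f) = (map fst xs @ [Time, Sit], Qty)"
    using assms(2) by (simp add: temporal_functional_fluent_def)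
  moreover have "map e (xs @ [t, s]) \<in> tuples M (map fst xs @ [Time, Sit])"
  proof -
    have "list_all2 (\<lambda>a \<sigma>. a \<in> carrier M \<sigma>) (map e vs) (map fst vs)" for vs
      using assms(5) by (simp add: assignment_def list_all2_conv_all_nth del: split_paired_All)
    from this[of "xs @ [t, s]"] show ?thesis
      using assms(3,4) by (simp add: tuples_def)
  qed
  moreover have "\<forall>vs\<in>tuples M (fst (fsig Sg (Fun f))).
      fint M (Fun f) vs \<in> carrier M (snd (fsig Sg (Fun f)))"
    using assms(1) unfolding sitcalc_structure_def by blast
  ultimately have "fint M (Fun f) (map e (xs @ [t, s])) \<in> carrier M Qty"
    by simp
  then show ?thesis by (simp add: fluent_tm_def comp_def)
qed

theorem theorem1:
  fixes Sg :: "('f, 'p) signature"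
    and D :: "('f, 'p) fm set"
    and f :: 'f
    and xs :: "var list" and y y' t s :: var
    and k :: nat
    and \<gamma> \<delta> :: "nat \<Rightarrow> ('f, 'p) fm"
  assumes "is_theory Sg D"
    and "temporal_functional_fluent Sg f (map fst xs)"
    and "fst y = Qty" and "fst y' = Qty" and "fst t = Time" and "fst s = Sit"
    and "distinct (xs @ [y, y', t, s])"
    and "k \<ge> 1"
    and "\<And>i. i \<in> {1..k} \<Longrightarrow> uniform_formula Sg s (set (xs @ [s])) (\<gamma> i)"
    and "\<And>i. i \<in> {1..k} \<Longrightarrow> uniform_formula Sg s (set (xs @ [y, t, s])) (\<delta> i)"
    and "\<And>i. i \<in> {1..k} \<Longrightarrow>
           entails TYPE('u) Sg D (Alls (xs @ [t, s]) (Imp (\<gamma> i) (Exists y (\<delta> i))))"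
  shows "equivalent_in_models_of TYPE('u) Sg D
    (Alls (xs @ [y, y', t, s])
      (Imp (And (Phi k \<gamma> \<delta>) (rename_free y y' (Phi k \<gamma> \<delta>))) (Eq (Var y) (Var y'))))
    (And
      (Alls (xs @ [y, t, s])
        (Imp (Phi k \<gamma> \<delta>) (Eq (fluent_tm f xs (Var t) s) (Var y))))
      (Alls (xs @ [t, s])
        (Imp (Neg (Eq (fluent_tm f xs (Var t) s) (fluent_tm f xs (start_tm s) s)))
          (Exists y (Phi k \<gamma> \<delta>)))))
    (Alls (xs @ [y, t, s])
      (Iff (Eq (fluent_tm f xs (Var t) s) (Var y))
        (Or (Phi k \<gamma> \<delta>)
          (And (Eq (Var y) (fluent_tm f xs (start_tm s) s)) (Neg (Psi k \<gamma>))))))"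
proof -
  define F where "F e M = eval M e (fluent_tm f xs (Var t) s)" for e and M :: "('f, 'p, 'u) interp"
  define F0 where "F0 e M = eval M e (fluent_tm f xs (start_tm s) s)"
    for e and M :: "('f, 'p, 'u) interp"
  \<comment> \<open>By distinctness \<open>y\<close> is none of \<open>xs\<close>, \<open>t\<close>,
    \<open>s\<close>, so it occurs in neither fluent term.\<close>
  have F_upd: "F (e(y := a)) M = F e M" and F0_upd: "F0 (e(y := a)) M = F0 e M" for e a M
    using assms(7) unfolding F_def F0_def
    by (intro eval_cong; auto simp: fluent_tm_def start_tm_def)+
  have \<gamma>_upd: "sat M (e(y := a)) r (\<gamma> i) \<longleftrightarrow> sat M e r (\<gamma> i)"
    if "i \<in> {1..k}" for M :: "('f, 'p, 'u) interp" and e a r i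
    using assms(7) assms(9)[OF that] by (intro sat_upd_not_free) (auto simp: uniform_formula_def)
  \<comment> \<open>Here the entailments enter: some \<open>\<gamma> i\<close> holds, so a value of
    \<open>y\<close> makes \<open>\<delta> i\<close> true, and moving \<open>y\<close> to that value
    leaves \<open>\<gamma> i\<close> true.\<close>
  have Phi_Psi: "\<exists>a\<in>carrier M Qty. sat M (e(y := a)) r (Phi k \<gamma> \<delta>)"
    if M: "model Sg D M" and er: "assignment M e r" and Psi: "sat M e r (Psi k \<gamma>)"
    for M :: "('f, 'p, 'u) interp" and e r
  proof -
    obtain i where i: "i \<in> {1..k}" "sat M e r (\<gamma> i)"
      using Psi by (auto simp: sat_Psi)
    have "M \<Turnstile> Imp (\<gamma> i) (Exists y (\<delta> i))"
      using assms(11)[OF i(1)] M by (simp add: entails_def true_in_Alls)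
    then have "\<exists>a\<in>carrier M Qty. sat M (e(y := a)) r (\<delta> i)"
      using er i(2) assms(3) by (simp add: true_in_def)
    then show ?thesis
      unfolding sat_Phi using i \<gamma>_upd by blast
  qed
  have Psi_Phi: "sat M e r (Psi k \<gamma>)" if "sat M (e(y := a)) r (Phi k \<gamma> \<delta>)"
    for M :: "('f, 'p, 'u) interp" and e r a
    using that \<gamma>_upd by (auto simp: sat_Phi sat_Psi)
  show ?thesis
    unfolding equivalent_in_models_of_def
  proof (intro allI impI)
    fix M :: "('f, 'p, 'u) interp"
    assume "model Sg D M \<and> M \<Turnstile> Alls (xs @ [y, y', t, s])
      (Imp (And (Phi k \<gamma> \<delta>) (rename_free y y' (Phi k \<gamma> \<delta>))) (Eq (Var y) (Var y')))"
    then have M: "model Sg D M" by blast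
    \<comment> \<open>\<open>?A\<close>, \<open>?B\<close> and \<open>?C\<close> are the two axioms
      and the biconditional read semantically; their universal closures are absorbed by the
      quantification over assignments.\<close>
    let ?A = "\<forall>e r. assignment M e r \<longrightarrow> sat M e r (Phi k \<gamma> \<delta>) \<longrightarrow> F e M = e y"
    let ?B = "\<forall>e r. assignment M e r \<longrightarrow> F e M \<noteq> F0 e M \<longrightarrow>
      (\<exists>a\<in>carrier M Qty. sat M (e(y := a)) r (Phi k \<gamma> \<delta>))"
    let ?C = "\<forall>e r. assignment M e r \<longrightarrow>
      (F e M = e y \<longleftrightarrow> sat M e r (Phi k \<gamma> \<delta>) \<or> e y = F0 e M \<and> \<not> sat M e r (Psi k \<gamma>))"
    have "?A \<and> ?B \<longleftrightarrow> ?C"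
    proof (intro iffI)
      assume AB: "?A \<and> ?B"
      show ?C
      proof (intro allI impI)
        fix e r assume er: "assignment M e r"
        show "F e M = e y \<longleftrightarrow>
          sat M e r (Phi k \<gamma> \<delta>) \<or> e y = F0 e M \<and> \<not> sat M e r (Psi k \<gamma>)"
        proof (cases "sat M e r (Psi k \<gamma>)")
          case True
          then obtain a where a: "a \<in> carrier M Qty" "sat M (e(y := a)) r (Phi k \<gamma> \<delta>)"
            using Phi_Psi M er by blast
          moreover have "assignment M (e(y := a)) r"
            using er a(1) assms(3) by (simp add: assignment_upd)
          ultimately have "F (e(y := a)) M = (e(y := a)) y"
            using AB by blast
          then have a_eq: "a = F e M" by (simp add: F_upd)
          \<comment> \<open>\<open>?A\<close> has forced the witness \<open>a\<close> to be the
            fluent's value. If that is also \<open>e y\<close>, the update is the identity, so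
            \<Phi> holds under \<open>e\<close> itself.\<close>
          have "sat M e r (Phi k \<gamma> \<delta>)" if "F e M = e y"
            using a(2) unfolding a_eq that by simp
          then show ?thesis
            using True AB er by blast
        next
          case False
          \<comment> \<open>Without \<Psi>, no value of \<open>y\<close> satisfies \<Phi>, so the
            contrapositive of \<open>?B\<close> applies.\<close>
          then have "F e M = F0 e M"
            using AB er Psi_Phi by blast
          moreover have "\<not> sat M e r (Phi k \<gamma> \<delta>)"
            using False Psi_Phi[of M e "e y" r] by auto
          ultimately show ?thesis
            using False by auto
        qed
      qed
    next
      assume C: ?C
      have ?B
      proof (intro allI impI)
        fix e r assume er: "assignment M e r" and ne: "F e M \<noteq> F0 e M"
        have carrier: "F e M \<in> carrier M Qty"
          using M eval_fluent_in_carrier[OF _ assms(2,5,6) er] by (simp add: F_def model_def)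
        then have "assignment M (e(y := F e M)) r"
          using er assms(3) by (simp add: assignment_upd)
        \<comment> \<open>With \<open>y\<close> set to the fluent's value the left side of
          \<open>?C\<close> is true. The second disjunct on the right would equate
          \<open>F e M\<close> with \<open>F0 e M\<close>, against \<open>ne\<close>, so \<Phi>
          remains.\<close>
        from C[rule_format, OF this] have "sat M (e(y := F e M)) r (Phi k \<gamma> \<delta>)"
          using ne by (simp add: F_upd F0_upd)
        then show "\<exists>a\<in>carrier M Qty. sat M (e(y := a)) r (Phi k \<gamma> \<delta>)"
          using carrier by blast
      qed
      \<comment> \<open>\<open>?A\<close> is the right-to-left half of \<open>?C\<close>, restricted
        to the first disjunct.\<close>
      then show "?A \<and> ?B" using C by blast
    qed
    then show "M \<Turnstile> And
      (Alls (xs @ [y, t, s])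
        (Imp (Phi k \<gamma> \<delta>) (Eq (fluent_tm f xs (Var t) s) (Var y))))
      (Alls (xs @ [t, s])
        (Imp (Neg (Eq (fluent_tm f xs (Var t) s) (fluent_tm f xs (start_tm s) s)))
          (Exists y (Phi k \<gamma> \<delta>)))) \<longleftrightarrow>
      M \<Turnstile> Alls (xs @ [y, t, s])
      (Iff (Eq (fluent_tm f xs (Var t) s) (Var y))
        (Or (Phi k \<gamma> \<delta>)
          (And (Eq (Var y) (fluent_tm f xs (start_tm s) s)) (Neg (Psi k \<gamma>)))))"
      unfolding true_in_And true_in_Alls by (simp add: true_in_def F_def F0_def assms(3))
  qed
qed

end
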